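(* Let $F$ be a clause set. The reasoning algorithm with inference rules A1, A2, and A3 terminates on $F$, i.e. every sequence of rule applications starting from $\mathcal{S}_0=\{F\}$ is finite. Also, the reasoning algorithm with inference rules $\mathrm{A1}^+$, $\mathrm{A2}^+$, and A3 terminates on $F$.
   Context: Conjunctive normal forms of $\mathcal{ALC}$ are defined by mutual induction: a concept literal is $A$, $\lnot A$ ($A$ a concept name), $\exists R.F$ or $\forall R.F$ ($R$ a role name, $F$ a conjunctive normal form); a clause is a finite disjunction of concept literals, represented as a set of literals; a conjunctive normal form is a finite conjunction of clauses, represented as a clause set (set of clauses). The complementary literal $\overline{L}$ is: $\overline{A}=\lnot A$, $\overline{\lnot A}=A$, $\overline{\exists R.F}=\forall R.\mathrm{CNF}(\lnot F)$, $\overline{\forall R.F}=\exists R.\mathrm{CNF}(\lnot F)$, where $\mathrm{CNF}(C)$ is the equivalent conjunctive normal form of an $\mathcal{ALC}$ concept $C$ obtained by pushing negations inward, distributing $\sqcup$ over $\sqcap$ and flattening. A derivation works on families (sets) of clause sets $\mathcal{S}_i$, starting with $\mathcal{S}_0=\{F\}$; $\mathcal{S}_{i+1}$ is obtained from $\mathcal{S}_i$ by applying one of the following rules to a clause set $F\in\mathcal{S}_i$: (A1) if $L\in CL$ for a clause $CL\in F$: replace $CL$ by $\{L\}$ (nondeterministic choice of $L$). (A2) if $\forall R.F_1\in CL$ for some clause $CL\in F$: remove from $F$ all clauses $CL'$ containing $\forall R.F_1$, and replace every literal $\exists R.F_2$ occurring in clauses of $F$ by $\exists R.(F_1\cup F_2)$.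 (A3) if all clauses of $F$ are unit clauses of the form $\{A\}$, $\{\lnot A\}$ or $\{\exists R.F'\}$: for some $\{\exists R.F_1\}\in F$, replace $F$ by $F\setminus\{\{\exists R.F_1\}\}$ and add $F_1$ to the family; $F$ is called the parent of $F_1$ with respect to $R$. ($\mathrm{A1}^+$) if $L\in CL$ for a clause $CL\in F$: replace every clause $CL'\in F$ with $L\in CL'$ by $\{L\}$, and every clause $CL'\in F$ with $\overline{L}\in CL'$ by $CL'\setminus\{\overline{L}\}$. ($\mathrm{A2}^+$) as A2, but applicable only if all clauses of $F$ are unit clauses. The first algorithm uses A1, A2, A3; the second uses $\mathrm{A1}^+$, $\mathrm{A2}^+$, A3.
   Formalization: A rule application is required to change the family of clause sets; otherwise A1 or A1⁺ could replace a unit clause {L} by itself forever (e.g. on F = {{A}}), so the claim would fail as literally stated. *)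

theory Defs
  imports "HOL-Library.FSet"
begin

text \<open>ALC concepts over concept names \<open>'c\<close> and role names \<open>'r\<close>.\<close>

datatype ('c, 'r) concept =
    Top
  | Bot
  | Name 'c
  | Not "('c, 'r) concept"
  | And "('c, 'r) concept" "('c, 'r) concept"
  | Or "('c, 'r) concept" "('c, 'r) concept"
  | Some_in 'r "('c, 'r) concept"
  | All_in 'r "('c, 'r) concept"

text \<open>The nested finite-set recursion renders the mutual induction of literals, clauses and
  conjunctive normal forms.\<close>

datatype ('c, 'r) literal =
    Pos 'c
  | Neg 'c
  | Ex 'r "('c, 'r) literal fset fset"
  | All 'r "('c, 'r) literal fset fset"

type_synonym ('c, 'r) clause = "('c, 'r) literal fset"
type_synonym ('c, 'r) clause_set = "('c, 'r) clause fset"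
type_synonym ('c, 'r) family = "('c, 'r) clause_set set"


subsection \<open>Conjunctive normal form and complementary literals\<close>

definition distrib_or ::
    "('c, 'r) clause_set \<Rightarrow> ('c, 'r) clause_set \<Rightarrow> ('c, 'r) clause_set" where
  "distrib_or F G = ffUnion ((\<lambda>C. (\<lambda>D. C |\<union>| D) |`| G) |`| F)"

fun CNF :: "('c, 'r) concept \<Rightarrow> ('c, 'r) clause_set" where
  "CNF Top = {||}"
| "CNF Bot = {|{||}|}"
| "CNF (Name A) = {|{|Pos A|}|}"
| "CNF (And C D) = CNF C |\<union>| CNF D"
| "CNF (Or C D) = distrib_or (CNF C) (CNF D)"
| "CNF (Some_in R C) = {|{|Ex R (CNF C)|}|}"
| "CNF (All_in R C) = {|{|All R (CNF C)|}|}"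
| "CNF (Not Top) = {|{||}|}"
| "CNF (Not Bot) = {||}"
| "CNF (Not (Name A)) = {|{|Neg A|}|}"
| "CNF (Not (Not C)) = CNF C"
| "CNF (Not (And C D)) = distrib_or (CNF (Not C)) (CNF (Not D))"
| "CNF (Not (Or C D)) = CNF (Not C) |\<union>| CNF (Not D)"
| "CNF (Not (Some_in R C)) = {|{|All R (CNF (Not C))|}|}"
| "CNF (Not (All_in R C)) = {|{|Ex R (CNF (Not C))|}|}"

text \<open>Reading a clause set back as a concept needs an enumeration of its members.  The choice is
  immaterial: \<open>CNF\<close> interprets the connectives by associative and commutative operations on
  clause sets.\<close>

definition enum_fset :: "'a fset \<Rightarrow> 'a list" where
  "enum_fset S = (SOME xs. distinct xs \<and> fset_of_list xs = S)"

definition Conj :: "('c, 'r) concept fset \<Rightarrow> ('c, 'r) concept" where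
  "Conj S = foldr And (enum_fset S) Top"

definition Disj :: "('c, 'r) concept fset \<Rightarrow> ('c, 'r) concept" where
  "Disj S = foldr Or (enum_fset S) Bot"

primrec literal_concept :: "('c, 'r) literal \<Rightarrow> ('c, 'r) concept" where
  "literal_concept (Pos A) = Name A"
| "literal_concept (Neg A) = Not (Name A)"
| "literal_concept (Ex R F) = Some_in R (Conj (Disj |`| (fimage literal_concept |`| F)))"
| "literal_concept (All R F) = All_in R (Conj (Disj |`| (fimage literal_concept |`| F)))"

definition clause_set_concept :: "('c, 'r) clause_set \<Rightarrow> ('c, 'r) concept" where
  "clause_set_concept F = Conj (Disj |`| (fimage literal_concept |`| F))"

fun compl :: "('c, 'r) literal \<Rightarrow> ('c, 'r) literal" where
  "compl (Pos A) = Neg A"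
| "compl (Neg A) = Pos A"
| "compl (Ex R F) = All R (CNF (Not (clause_set_concept F)))"
| "compl (All R F) = Ex R (CNF (Not (clause_set_concept F)))"


subsection \<open>Inference rules\<close>

text \<open>A rule relates a clause set \<open>F\<close> to the set of clause sets that take its place in the
  family.\<close>

definition is_unit :: "('c, 'r) clause \<Rightarrow> bool" where
  "is_unit CL \<longleftrightarrow> (\<exists>L. CL = {|L|})"

inductive A1 :: "('c, 'r) clause_set \<Rightarrow> ('c, 'r) family \<Rightarrow> bool" where
  "CL |\<in>| F \<Longrightarrow> L |\<in>| CL \<Longrightarrow> A1 F {finsert {|L|} (F |-| {|CL|})}"

text \<open>Only the literals of the clauses themselves are affected, not those nested below a
  quantifier.\<close>

fun extend_ex :: "'r \<Rightarrow> ('c, 'r) clause_set \<Rightarrow> ('c, 'r) literal \<Rightarrow> ('c, 'r) literal" where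
  "extend_ex R F1 (Ex R' F2) = (if R' = R then Ex R (F1 |\<union>| F2) else Ex R' F2)"
| "extend_ex R F1 L = L"

definition propagate_all ::
    "'r \<Rightarrow> ('c, 'r) clause_set \<Rightarrow> ('c, 'r) clause_set \<Rightarrow> ('c, 'r) clause_set" where
  "propagate_all R F1 F =
    (\<lambda>CL. extend_ex R F1 |`| CL) |`| ffilter (\<lambda>CL. All R F1 |\<notin>| CL) F"

inductive A2 :: "('c, 'r) clause_set \<Rightarrow> ('c, 'r) family \<Rightarrow> bool" where
  "CL |\<in>| F \<Longrightarrow> All R F1 |\<in>| CL \<Longrightarrow> A2 F {propagate_all R F1 F}"

inductive A3 :: "('c, 'r) clause_set \<Rightarrow> ('c, 'r) family \<Rightarrow> bool" where
  "(\<And>CL. CL |\<in>| F \<Longrightarrow>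
      (\<exists>A. CL = {|Pos A|}) \<or> (\<exists>A. CL = {|Neg A|}) \<or> (\<exists>R' F'. CL = {|Ex R' F'|})) \<Longrightarrow>
   {|Ex R F1|} |\<in>| F \<Longrightarrow>
   A3 F {F |-| {|{|Ex R F1|}|}, F1}"

text \<open>A clause containing both \<open>L\<close> and its complement becomes \<open>{|L|}\<close>.\<close>

definition assert_literal :: "('c, 'r) literal \<Rightarrow> ('c, 'r) clause \<Rightarrow> ('c, 'r) clause" where
  "assert_literal L CL =
    (if L |\<in>| CL then {|L|} else if compl L |\<in>| CL then CL |-| {|compl L|} else CL)"

inductive A1_plus :: "('c, 'r) clause_set \<Rightarrow> ('c, 'r) family \<Rightarrow> bool" where
  "CL |\<in>| F \<Longrightarrow> L |\<in>| CL \<Longrightarrow> A1_plus F {assert_literal L |`| F}"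

inductive A2_plus :: "('c, 'r) clause_set \<Rightarrow> ('c, 'r) family \<Rightarrow> bool" where
  "(\<And>CL. CL |\<in>| F \<Longrightarrow> is_unit CL) \<Longrightarrow> A2 F G \<Longrightarrow> A2_plus F G"


subsection \<open>Derivations\<close>

text \<open>A rule application has to change the family.  This excludes exactly the vacuous
  applications of \<open>A1\<close> and \<open>A1_plus\<close>, for instance replacing a unit clause \<open>{|L|}\<close> by itself,
  which could otherwise be repeated forever.\<close>

inductive derivation_step ::
    "(('c, 'r) clause_set \<Rightarrow> ('c, 'r) family \<Rightarrow> bool) \<Rightarrow> ('c, 'r) family \<Rightarrow> ('c, 'r) family \<Rightarrow> bool"
  for rl where
  "F \<in> S \<Longrightarrow> rl F G \<Longrightarrow> S' = (S - {F}) \<union> G \<Longrightarrow> S' \<noteq> S \<Longrightarrow> derivation_step rl S S'"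

definition terminates_on ::
    "(('c, 'r) clause_set \<Rightarrow> ('c, 'r) family \<Rightarrow> bool) \<Rightarrow> ('c, 'r) clause_set \<Rightarrow> bool" where
  "terminates_on rl F \<longleftrightarrow>
    \<not> (\<exists>S :: nat \<Rightarrow> ('c, 'r) family. S 0 = {F} \<and> (\<forall>i. derivation_step rl (S i) (S (Suc i))))"

definition algorithm1 :: "('c, 'r) clause_set \<Rightarrow> ('c, 'r) family \<Rightarrow> bool" where
  "algorithm1 F G \<longleftrightarrow> A1 F G \<or> A2 F G \<or> A3 F G"

definition algorithm2 :: "('c, 'r) clause_set \<Rightarrow> ('c, 'r) family \<Rightarrow> bool" where
  "algorithm2 F G \<longleftrightarrow> A1_plus F G \<or> A2_plus F G \<or> A3 F G"

end

theory Submission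
  imports Defs "HOL-Library.Multiset"
begin

text \<open>
  Compare clause sets lexicographically by their quantifier depth and then by their number of
  literal occurrences. No rule increases the depth: in A2 the literal \<open>\<forall>R.F\<^sub>1\<close> already occurs at
  the level of the literals \<open>\<exists>R.F\<^sub>2\<close> that are turned into \<open>\<exists>R.(F\<^sub>1 \<union> F\<^sub>2)\<close>. Every
  effective application of A1, A1\<open>\<^sup>+\<close>, A2 or A2\<open>\<^sup>+\<close> removes literal occurrences, and A3 replaces a
  clause set by one with fewer literal occurrences and one of smaller depth. Hence a derivation
  step replaces one clause set by finitely many smaller ones, which decreases the family in the
  multiset order.
\<close>

text \<open>The case \<open>G = {F}\<close> admits vacuous rule applications, which
  \<open>derivation_step\<close> excludes because the family must change.\<close>

lemma terminates_onI:
  assumes "wf r"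
    and rl: "\<And>F G. rl F G \<Longrightarrow> finite G \<and> (G = {F} \<or> (\<forall>H\<in>G. (H, F) \<in> r))"
  shows "terminates_on rl F"
  unfolding terminates_on_def
proof (rule notI, elim exE conjE)
  fix S
  assume S0: "S 0 = {F}" and steps: "\<forall>i. derivation_step rl (S i) (S (Suc i))"
  \<comment> \<open>\<open>mset_set\<close> is empty on infinite sets, so the multiset order sees a
    family only if it is finite.\<close>
  have fin: "finite (S i)" for i
  proof (induction i)
    case (Suc i)
    then show ?case
      using steps[rule_format, of i] rl by (auto elim!: derivation_step.cases)
  qed (simp add: S0)
  have "(mset_set (S (Suc i)), mset_set (S i)) \<in> mult1 r" for i
    using steps[rule_format, of i]
  proof cases
    case (1 H G)
    \<comment> \<open>Replacing \<open>H\<close> by itself would leave \<open>S i\<close>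
      unchanged.\<close>
    have "G \<noteq> {H}"
      using 1 by auto
    with rl[OF 1(2)] have G: "finite G" "\<forall>K\<in>G. (K, H) \<in> r"
      by auto
    \<comment> \<open>A family is a set, so members of \<open>G\<close> already present in
      \<open>T\<close> are merged with them; only \<open>G - T\<close> is added to the
      multiset.\<close>
    define T where "T = S i - {H}"
    have T: "finite T"
      using fin[of i] by (simp add: T_def)
    have "S (Suc i) = T \<union> (G - T)"
      using 1 by (auto simp: T_def)
    then have "mset_set (S (Suc i)) = mset_set T + mset_set (G - T)"
      using T G by (metis Diff_disjoint finite_Diff mset_set_Union)
    moreover have "mset_set (S i) = add_mset H (mset_set T)"
      using fin[of i] 1 by (simp add: T_def mset_set.remove)
    ultimately show ?thesis
      using G by (intro mult1I) auto
  qed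
  then show False
    using wf_mult1[OF \<open>wf r\<close>] unfolding wf_iff_no_infinite_down_chain
    by (elim notE) (rule exI[of _ "\<lambda>i. mset_set (S i)"], blast)
qed

text \<open>On finite sets of naturals \<open>Sup\<close> is the maximum, with value 0 on the empty
  set; this gives depth 0 to a clause set without literals.\<close>

primrec literal_depth :: "('c, 'r) literal \<Rightarrow> nat" where
  "literal_depth (Pos A) = 0"
| "literal_depth (Neg A) = 0"
| "literal_depth (Ex R F) = Suc (Sup (fset (ffUnion (fimage literal_depth |`| F))))"
| "literal_depth (All R F) = Suc (Sup (fset (ffUnion (fimage literal_depth |`| F))))"

definition depth :: "('c, 'r) clause_set \<Rightarrow> nat" where
  "depth F = Sup (fset (ffUnion (fimage literal_depth |`| F)))"

lemma literal_depth_quantifier [simp]: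
  "literal_depth (Ex R F) = Suc (depth F)"
  "literal_depth (All R F) = Suc (depth F)"
  by (simp_all add: depth_def)

declare literal_depth.simps(3,4) [simp del]

lemma Sup_nat_le_iff:
  fixes X :: "nat set"
  assumes "finite X"
  shows "Sup X \<le> n \<longleftrightarrow> (\<forall>x\<in>X. x \<le> n)"
  using assms by (auto simp: Sup_nat_def)

lemma depth_le_iff: "depth F \<le> n \<longleftrightarrow> (\<forall>CL. CL |\<in>| F \<longrightarrow> (\<forall>L. L |\<in>| CL \<longrightarrow> literal_depth L \<le> n))"
  unfolding depth_def by (subst Sup_nat_le_iff) (auto simp: ffUnion.rep_eq)

lemma literal_depth_le: "CL |\<in>| F \<Longrightarrow> L |\<in>| CL \<Longrightarrow> literal_depth L \<le> depth F"
  using depth_le_iff by blast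

lemma depth_union: "depth (F |\<union>| G) \<le> max (depth F) (depth G)"
  by (subst depth_le_iff) (auto simp: le_max_iff_disj literal_depth_le)

text \<open>Only literals directly in a clause count, once per clause containing them. What A2
  inserts below an existential quantifier is thus invisible here.\<close>

definition literal_count :: "('c, 'r) clause_set \<Rightarrow> nat" where
  "literal_count F = (\<Sum>CL\<in>fset F. fcard CL)"

abbreviation smaller :: "('c, 'r) clause_set rel" where
  "smaller \<equiv> measures [depth, literal_count]"

lemma literal_count_remove:
  assumes "CL |\<in>| F"
  shows "literal_count F = fcard CL + literal_count (F |-| {|CL|})"
  using assms by (simp add: literal_count_def sum.remove)

lemma literal_count_finsert_le: "literal_count (finsert CL F) \<le> fcard CL + literal_count F"
  by (cases "CL |\<in>| F") (auto simp: literal_count_def sum.insert_if)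

text \<open>Distinct clauses may have equal images, and such merging only lowers the count.\<close>

lemma literal_count_image_le:
  assumes "\<And>CL. CL |\<in>| F \<Longrightarrow> fcard (f CL) \<le> fcard CL"
  shows "literal_count (f |`| F) \<le> literal_count F"
proof -
  have "literal_count (f |`| F) \<le> (\<Sum>CL\<in>fset F. fcard (f CL))"
    unfolding literal_count_def fimage.rep_eq
    using sum_image_le[of "fset F" fcard f] by (simp add: o_def)
  also have "\<dots> \<le> literal_count F"
    unfolding literal_count_def using assms by (intro sum_mono) auto
  finally show ?thesis .
qed

lemma literal_count_image_less:
  assumes le: "\<And>CL. CL |\<in>| F \<Longrightarrow> fcard (f CL) \<le> fcard CL"
    and CL: "CL |\<in>| F" "fcard (f CL) < fcard CL"
  shows "literal_count (f |`| F) < literal_count F"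
proof -
  have "f |`| F = finsert (f CL) (f |`| (F |-| {|CL|}))"
    using CL by auto
  then have "literal_count (f |`| F) \<le> fcard (f CL) + literal_count (f |`| (F |-| {|CL|}))"
    using literal_count_finsert_le by metis
  also have "literal_count (f |`| (F |-| {|CL|})) \<le> literal_count (F |-| {|CL|})"
    using le by (intro literal_count_image_le) auto
  also have "fcard (f CL) + literal_count (F |-| {|CL|}) < literal_count F"
    using CL by (simp add: literal_count_remove)
  finally show ?thesis by simp
qed

lemma fcard_pos: "L |\<in>| CL \<Longrightarrow> 0 < fcard CL"
  by (auto simp: fcard.rep_eq card_gt_0_iff)

lemma fcard_gt_1:
  assumes "L |\<in>| CL" "CL \<noteq> {|L|}"
  shows "1 < fcard CL"
proof -
  have "{|L|} |\<subset>| CL"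
    using assms by auto
  then have "fcard {|L|} < fcard CL"
    by (rule pfsubset_fcard_mono)
  then show ?thesis
    by (simp add: fcard.rep_eq)
qed

lemma A1_smaller:
  assumes "A1 F G"
  shows "finite G \<and> (G = {F} \<or> (\<forall>H\<in>G. (H, F) \<in> smaller))"
  using assms
proof cases
  case (1 CL L)
  show ?thesis
  proof (cases "CL = {|L|}")
    case True
    then show ?thesis using 1 by auto
  next
    case False
    let ?F = "finsert {|L|} (F |-| {|CL|})"
    \<comment> \<open>Only an inequality, since \<open>{|L|}\<close> may already be a clause of
      \<open>F\<close>.\<close>
    have "literal_count ?F \<le> 1 + literal_count (F |-| {|CL|})"
      using literal_count_finsert_le[of "{|L|}"] by (simp add: fcard.rep_eq)
    also have "\<dots> < literal_count F"
      using fcard_gt_1[OF 1(3) False] 1 by (simp add: literal_count_remove)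
    finally have "literal_count ?F < literal_count F" .
    moreover have "depth ?F \<le> depth F"
      using 1 by (auto simp: depth_le_iff[of ?F] intro: literal_depth_le)
    ultimately show ?thesis
      using 1 by auto
  qed
qed

lemma A2_smaller:
  assumes "A2 F G"
  shows "finite G \<and> (G = {F} \<or> (\<forall>H\<in>G. (H, F) \<in> smaller))"
  using assms
proof cases
  case (1 CL R F1)
  let ?E = "ffilter (\<lambda>CL. All R F1 |\<notin>| CL) F"
  have "literal_count (propagate_all R F1 F) \<le> literal_count ?E"
    unfolding propagate_all_def
    by (rule literal_count_image_le) (simp add: fcard.rep_eq card_image_le)
  \<comment> \<open>The filter drops at least \<open>CL\<close>, which is nonempty, so its removal
    strictly lowers the count.\<close>
  also have "literal_count ?E \<le> literal_count (F |-| {|CL|})"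
    unfolding literal_count_def using 1 by (intro sum_mono2) auto
  also have "\<dots> < literal_count F"
    using 1 fcard_pos[OF 1(3)] by (simp add: literal_count_remove)
  finally have count: "literal_count (propagate_all R F1 F) < literal_count F" .
  have F1: "Suc (depth F1) \<le> depth F"
    using literal_depth_le[OF 1(2,3)] by simp
  have "literal_depth (extend_ex R F1 L) \<le> max (Suc (depth F1)) (literal_depth L)" for L
    using depth_union[of F1] by (cases L) auto
  then have "literal_depth (extend_ex R F1 L) \<le> depth F" if "D |\<in>| F" "L |\<in>| D" for D L
    using literal_depth_le[OF that] F1 by (meson max.bounded_iff order_trans)
  then have "depth (propagate_all R F1 F) \<le> depth F"
    unfolding propagate_all_def by (subst depth_le_iff) auto
  with count show ?thesis
    using 1 by auto
qed

lemma A2_plus_smaller: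
  assumes "A2_plus F G"
  shows "finite G \<and> (G = {F} \<or> (\<forall>H\<in>G. (H, F) \<in> smaller))"
  using assms by cases (rule A2_smaller)

lemma A3_smaller:
  assumes "A3 F G"
  shows "finite G \<and> (G = {F} \<or> (\<forall>H\<in>G. (H, F) \<in> smaller))"
  using assms
proof cases
  case (1 R F1)
  have "literal_count (F |-| {|{|Ex R F1|}|}) < literal_count F"
    using 1 by (simp add: literal_count_remove fcard.rep_eq)
  moreover have "depth (F |-| {|{|Ex R F1|}|}) \<le> depth F"
    by (auto simp: depth_le_iff[of "F |-| _"] intro: literal_depth_le)
  \<comment> \<open>\<open>F1\<close> may contain more literals than \<open>F\<close>; since depth
    is compared first, its strict decrease suffices.\<close>
  moreover have "depth F1 < depth F"
    using literal_depth_le[OF 1(3), of "Ex R F1"] by simp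
  ultimately show ?thesis
    using 1 by auto
qed

text \<open>Each outcome of \<open>assert_literal\<close> is a subset of the clause, so a change
  means a proper inclusion.\<close>

lemma fcard_assert_literal_less:
  assumes "assert_literal L CL \<noteq> CL"
  shows "fcard (assert_literal L CL) < fcard CL"
proof (cases "L |\<in>| CL")
  case True
  then show ?thesis
    using assms fcard_gt_1[OF True] by (auto simp: assert_literal_def fcard.rep_eq)
next
  case False
  then have "assert_literal L CL |\<subset>| CL"
    using assms by (auto simp: assert_literal_def split: if_splits)
  then show ?thesis
    by (rule pfsubset_fcard_mono)
qed

lemma A1_plus_smaller:
  assumes "A1_plus F G"
  shows "finite G \<and> (G = {F} \<or> (\<forall>H\<in>G. (H, F) \<in> smaller))"
  using assms
proof cases
  case (1 CL L)
  let ?F = "assert_literal L |`| F"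
  show ?thesis
  \<comment> \<open>The clause that shrinks need not be \<open>CL\<close>: it may already be a unit
    clause while another clause contains \<open>L\<close> or \<open>compl L\<close>.\<close>
  proof (cases "\<forall>D. D |\<in>| F \<longrightarrow> assert_literal L D = D")
    case True
    then have "?F = F"
      by force
    then show ?thesis using 1 by simp
  next
    case False
    then obtain D where D: "D |\<in>| F" "fcard (assert_literal L D) < fcard D"
      using fcard_assert_literal_less by blast
    have "fcard (assert_literal L D) \<le> fcard D" for D
      using fcard_assert_literal_less[of L D] by fastforce
    then have "literal_count ?F < literal_count F"
      using D by (rule literal_count_image_less)
    \<comment> \<open>No new literal arises, so the depth cannot grow.\<close>
    moreover have "assert_literal L D |\<subseteq>| D" for D
      by (auto simp: assert_literal_def)
    then have "depth ?F \<le> depth F"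
      by (auto simp: depth_le_iff[of ?F] intro: literal_depth_le)
    ultimately show ?thesis
      using 1 by auto
  qed
qed

theorem mainTheorem2:
  fixes F :: "('c, 'r) clause_set"
  shows "terminates_on algorithm1 F \<and> terminates_on algorithm2 F"
proof
  show "terminates_on algorithm1 F"
  proof (rule terminates_onI[OF wf_measures])
    fix F :: "('c, 'r) clause_set" and G
    assume "algorithm1 F G"
    then show "finite G \<and> (G = {F} \<or> (\<forall>H\<in>G. (H, F) \<in> smaller))"
      unfolding algorithm1_def by (elim disjE A1_smaller A2_smaller A3_smaller)
  qed
  show "terminates_on algorithm2 F"
  proof (rule terminates_onI[OF wf_measures])
    fix F :: "('c, 'r) clause_set" and G
    assume "algorithm2 F G"
    then show "finite G \<and> (G = {F} \<or> (\<forall>H\<in>G. (H, F) \<in> smaller))"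
      unfolding algorithm2_def
      by (elim disjE A1_plus_smaller A2_plus_smaller A3_smaller)
  qed
qed

end
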